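(* Let $D\subseteq\mathbb{C}$ be an open set and let $\mathcal{F}\subseteq C(D,\mathbb{C})$. Then $\mathcal{F}$ is topologically transitive on $D$ if and only if for every non-empty open set $V\subseteq\mathbb{C}$ the set $\{z\in D : f(z)\in V \text{ for some } f\in\mathcal{F}\}$ is dense in $D$.
   Context: $C(D,\mathbb{C})$ denotes the class of all continuous functions from $D$ to $\mathbb{C}$. A family $\mathcal{F}\subseteq C(D,\mathbb{C})$ is topologically transitive on $D$ if for all non-empty open sets $U\subseteq D$ and $V\subseteq\mathbb{C}$ there exists $f\in\mathcal{F}$ with $f(U)\cap V\neq\emptyset$. *)

theory Defs
  imports "HOL-Analysis.Analysis"
begin

text \<open>
  The class \<open>C(D, \<complex>)\<close>. HOL functions are total, so an element of \<open>C(D, \<complex>)\<close> is represented by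
  any total function that is continuous on \<open>D\<close>; its values outside \<open>D\<close> are irrelevant.
\<close>

definition continuous_functions :: "complex set \<Rightarrow> (complex \<Rightarrow> complex) set" where
  "continuous_functions D = {f. continuous_on D f}"

text \<open>
  Intended for open \<open>D\<close>, where the open subsets of the plane contained in \<open>D\<close> are exactly the
  relatively open subsets of \<open>D\<close>.
\<close>

definition topologically_transitive_on :: "(complex \<Rightarrow> complex) set \<Rightarrow> complex set \<Rightarrow> bool" where
  "topologically_transitive_on F D \<longleftrightarrow>
     (\<forall>U V. open U \<and> U \<noteq> {} \<and> U \<subseteq> D \<and> open V \<and> V \<noteq> {} \<longrightarrow>
        (\<exists>f\<in>F. f ` U \<inter> V \<noteq> {}))"

definition dense_in :: "complex set \<Rightarrow> complex set \<Rightarrow> bool" where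
  "dense_in S D \<longleftrightarrow> S \<subseteq> D \<and> top_of_set D closure_of S = D"

end

theory Submission
  imports Defs
begin

text \<open>
  Both sides say that whenever \<open>U \<subseteq> D\<close> and \<open>V\<close> are non-empty and open, some point of \<open>U\<close> is sent
  into \<open>V\<close> by a member of the family. Transitivity asks this for each pair \<open>(U, V)\<close>; for a fixed
  \<open>V\<close> and all \<open>U\<close> together, it is density of the union of the preimages of \<open>V\<close>, because a set is
  dense exactly when it meets every non-empty open set.
\<close>

text \<open>
  Since \<open>D\<close> is open in the plane, the test sets for density in the subspace \<open>D\<close> may be taken
  to be open in the plane, as in the definition of transitivity.
\<close>

lemma dense_in_open_iff:
  assumes "open D" and "S \<subseteq> D"
  shows "dense_in S D \<longleftrightarrow> (\<forall>U. open U \<and> U \<noteq> {} \<and> U \<subseteq> D \<longrightarrow> S \<inter> U \<noteq> {})"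
  using assms dense_intersects_open[of "top_of_set D" S]
  by (auto simp: dense_in_def openin_open_eq)

theorem theorem4p2:
  fixes D :: "complex set" and F :: "(complex \<Rightarrow> complex) set"
  assumes "open D" and "F \<subseteq> continuous_functions D"
  shows "topologically_transitive_on F D \<longleftrightarrow>
    (\<forall>V :: complex set. open V \<and> V \<noteq> {} \<longrightarrow>
       dense_in {z \<in> D. \<exists>f\<in>F. f z \<in> V} D)"
proof -
  have meets_iff: "{z \<in> D. \<exists>f\<in>F. f z \<in> V} \<inter> U \<noteq> {} \<longleftrightarrow> (\<exists>f\<in>F. f ` U \<inter> V \<noteq> {})"
    if "U \<subseteq> D" for U V
    using that by blast
  have dense_iff: "dense_in {z \<in> D. \<exists>f\<in>F. f z \<in> V} D \<longleftrightarrow>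
      (\<forall>U. open U \<and> U \<noteq> {} \<and> U \<subseteq> D \<longrightarrow> (\<exists>f\<in>F. f ` U \<inter> V \<noteq> {}))" for V
    by (subst dense_in_open_iff[OF \<open>open D\<close>]) (use meets_iff in auto)
  show ?thesis
    unfolding topologically_transitive_on_def dense_iff by blast
qed

end
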